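(* For integers $\nu\ge1$ and $n>\nu(2\nu+3)$, \[ (-1)^\nu\left(\sum_{\tau=0}^{\nu}(-1)^\tau p_o\big(2n+1-\tau(2\tau+1)\big)-\sum_{\tau=0}^{\nu-1}(-1)^\tau p_o\big(2n+1-(\tau+1)(2\tau+1)\big)\right)=p_o(3,4,\nu;2n+1)+p_o(1,4,\nu;2n+1). \]
   Context: $p_o(n)$ is the number of partitions of $n$ into odd parts. Definition of $M(a,m,\nu;n)$ (integers $\nu\ge0$, $1\le a<m$, $n\ge0$): for a partition $\lambda_1\ge\dots\ge\lambda_k$ of $n$ into parts $\equiv a\pmod m$, put $\ell_i=(\lambda_i-a)/m+1$ (number of boxes of the row of $\lambda_i$ in the $m$-modular Young diagram), and let $t$ be the largest integer $0\le t\le k$ with $\ell_t\ge t+\nu+2$ (height of the $(\nu+2)$-Durfee rectangle, of width $t+\nu+2$). $M(a,m,\nu;n)$ counts partitions of $n$ into parts $\equiv a\pmod m$ in which each of $a,a+m,\dots,a+m\nu$ occurs at least once and $\ell_i<t+\nu+2$ for all $i>t$. Definition: for $a\in\{1,3\}$, $p_o(a,4,\nu;n)$ counts partitions of $n$ into odd parts such that, if $\alpha$ is the sum of the parts $\not\equiv a\pmod 4$, the parts $\equiv a\pmod 4$ form a partition counted by $M(a,4,\nu;n-\alpha)$. *)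

theory Defs
  imports "HOL-Library.Multiset" "HOL-Number_Theory.Cong"
begin

text \<open>A partition of \<open>n\<close> is the multiset of its (positive) parts, whose sum is \<open>n\<close>.\<close>

definition partitions_of :: "nat \<Rightarrow> nat multiset set" where
  "partitions_of n = {P. (\<forall>p \<in># P. 0 < p) \<and> \<Sum>\<^sub># P = n}"

definition odd_partitions :: "nat \<Rightarrow> nat multiset set" where
  "odd_partitions n = {P \<in> partitions_of n. \<forall>p \<in># P. odd p}"

definition p_o :: "nat \<Rightarrow> nat" where
  "p_o n = card (odd_partitions n)"

definition part :: "nat multiset \<Rightarrow> nat \<Rightarrow> nat" where
  \<comment> \<open>\<open>\<lambda>\<^sub>i\<close>, the \<open>i\<close>-th largest part, for \<open>1 \<le> i \<le> size P\<close>\<close>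
  "part P i = rev (sorted_list_of_multiset P) ! (i - 1)"

definition row_length :: "nat \<Rightarrow> nat \<Rightarrow> nat multiset \<Rightarrow> nat \<Rightarrow> nat" where
  \<comment> \<open>\<open>\<ell>\<^sub>i\<close>; subtraction and division are exact when the parts are congruent
     to \<open>a\<close> modulo \<open>m\<close> and \<open>a < m\<close>\<close>
  "row_length a m P i = (part P i - a) div m + 1"

definition durfee_height :: "nat \<Rightarrow> nat \<Rightarrow> nat \<Rightarrow> nat multiset \<Rightarrow> nat" where
  \<comment> \<open>height of the \<open>(\<nu>+2)\<close>-Durfee rectangle; the condition on \<open>\<ell>\<^sub>t\<close> is void for \<open>t = 0\<close>\<close>
  "durfee_height a m \<nu> P =
     Max {t. t \<le> size P \<and> (t = 0 \<or> row_length a m P t \<ge> t + \<nu> + 2)}"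

definition M_partitions :: "nat \<Rightarrow> nat \<Rightarrow> nat \<Rightarrow> nat \<Rightarrow> nat multiset set" where
  "M_partitions a m \<nu> n =
     {P \<in> partitions_of n.
        (\<forall>p \<in># P. [p = a] (mod m)) \<and>
        (\<forall>j \<le> \<nu>. a + m * j \<in># P) \<and>
        (\<forall>i. durfee_height a m \<nu> P < i \<and> i \<le> size P \<longrightarrow>
               row_length a m P i < durfee_height a m \<nu> P + \<nu> + 2)}"

definition M_count :: "nat \<Rightarrow> nat \<Rightarrow> nat \<Rightarrow> nat \<Rightarrow> nat" where
  "M_count a m \<nu> n = card (M_partitions a m \<nu> n)"

definition p_o4 :: "nat \<Rightarrow> nat \<Rightarrow> nat \<Rightarrow> nat" where
  \<comment> \<open>\<open>p\<^sub>o(a,4,\<nu>;n)\<close>, meant for \<open>a \<in> {1,3}\<close>\<close>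
  "p_o4 a \<nu> n = card {P \<in> odd_partitions n.
     let \<alpha> = \<Sum>\<^sub># (filter_mset (\<lambda>p. \<not> [p = a] (mod 4)) P)
     in filter_mset (\<lambda>p. [p = a] (mod 4)) P \<in> M_partitions a 4 \<nu> (n - \<alpha>)}"

end

theory Submission
  imports Defs
begin

text \<open>
  Take a partition into parts congruent to \<open>a\<close> modulo \<open>m\<close> that contains \<open>a, a + m, \<dots>, a + m \<nu>\<close>, and
  let \<open>c t\<close> be the number of its parts \<open>\<ge> a + m (t + \<nu> + 1)\<close>. As \<open>c\<close> is antitone, the Durfee condition
  in the definition of \<open>M(a,m,\<nu>;n)\<close> says exactly that \<open>c\<close> has a fixed point. If it has none, there
  is a unique \<open>t\<close> with \<open>c (t + 1) \<le> t < c t\<close>; lowering one part \<open>a + m (t + \<nu> + 1)\<close> to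
  \<open>a + m (\<nu> + 1)\<close> and raising each of the \<open>t\<close> largest parts by \<open>m\<close> gives a bijection onto the
  partitions counted by \<open>M(a,m,\<nu>+1;n)\<close>. Hence
  \<open>p\<^sub>o(a,4,\<nu>;N) + p\<^sub>o(a,4,\<nu>+1;N) = p\<^sub>o(N - (\<nu>+1)(2\<nu>+a))\<close>, so that the difference of the two sides of
  the theorem changes only its sign with \<open>\<nu>\<close>. For large \<open>\<nu>\<close> the right side is zero, and it remains
  to see that \<open>\<Sum>\<^sub>j (-1)\<^sup>j p\<^sub>o(N - j(2j-1)) = 0\<close>, summed over all integers \<open>j\<close>, for odd \<open>N\<close>.

  Write a partition into odd parts as \<open>E + R + R\<close> with \<open>E\<close> a finite set. Encoding the odd numbers
  as \<open>|4i+1|\<close>, \<open>i \<in> \<int>\<close>, gives \<open>E\<close> a charge, and shifting the corresponding Maya diagram shows that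
  the number of sets \<open>E\<close> of charge \<open>c\<close> and sum \<open>z\<close> depends only on \<open>z - c(2c-1)\<close>. Exchanging
  \<open>j\<close> and \<open>c\<close> therefore preserves the count, while for odd \<open>N\<close> it reverses the sign, since
  \<open>j + c\<close> is then odd.
\<close>

subsection \<open>The Durfee condition as a fixed point\<close>

text \<open>In a weakly decreasing list the entries \<ge> \<open>w\<close> form a prefix.\<close>

lemma nth_ge_iff_length_filter:
  fixes xs :: "'a::linorder list"
  assumes "sorted_wrt (\<ge>) xs" "i < length xs"
  shows "w \<le> xs ! i \<longleftrightarrow> i < length (filter (\<lambda>x. w \<le> x) xs)"
  using assms
proof (induction xs arbitrary: i)
  case (Cons x xs)
  have empty: "filter (\<lambda>x. w \<le> x) xs = []" if "\<not> w \<le> x"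
    using Cons.prems(1) that by (auto simp: filter_empty_conv)
  show ?case
  proof (cases i)
    case 0
    then show ?thesis using empty by auto
  next
    case (Suc i')
    with Cons.prems have i': "i' < length xs" by simp
    then have "xs ! i' \<le> x" using Cons.prems(1) by simp
    then show ?thesis using Cons.IH[of i'] Cons.prems i' Suc empty by auto
  qed
qed simp

lemma part_ge_iff:
  assumes "1 \<le> i" "i \<le> size P"
  shows "w \<le> part P i \<longleftrightarrow> i \<le> size {#p \<in># P. w \<le> p#}"
proof -
  let ?xs = "rev (sorted_list_of_multiset P)"
  have "size {#p \<in># P. w \<le> p#} = length (filter (\<lambda>p. w \<le> p) ?xs)"
    by (metis mset_filter mset_rev mset_sorted_list_of_multiset size_mset)
  moreover have "sorted_wrt (\<ge>) ?xs"
    by (simp add: sorted_wrt_rev)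
  moreover have "length ?xs = size P"
    by (metis mset_rev mset_sorted_list_of_multiset size_mset)
  ultimately show ?thesis
    using nth_ge_iff_length_filter[of ?xs "i - 1" w] assms by (auto simp: part_def)
qed

lemma part_in_mset:
  assumes "1 \<le> i" "i \<le> size P"
  shows "part P i \<in># P"
proof -
  have "length (rev (sorted_list_of_multiset P)) = size P"
    by (metis mset_rev mset_sorted_list_of_multiset size_mset)
  then have "part P i \<in> set (rev (sorted_list_of_multiset P))"
    unfolding part_def using assms by (intro nth_mem) simp
  then show ?thesis by simp
qed

text \<open>Conjugation in the modular diagram: row \<open>i\<close> meets column
  \<open>k + 1\<close> iff that column has height at least \<open>i\<close>. This trades the ordered
  list of parts for a cardinality.\<close>

lemma row_length_gt_iff:
  assumes "a < m" "\<forall>p \<in># P. [p = a] (mod m)" "1 \<le> i" "i \<le> size P"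
  shows "k < row_length a m P i \<longleftrightarrow> i \<le> size {#p \<in># P. a + m * k \<le> p#}"
proof -
  have "part P i mod m = a"
    using assms part_in_mset[OF assms(3,4)] by (auto simp: cong_def)
  then have "part P i = a + m * (part P i div m)"
    using mult_div_mod_eq[of m "part P i"] by simp
  then obtain r where r: "part P i = a + m * r" ..
  have "k < row_length a m P i \<longleftrightarrow> a + m * k \<le> part P i"
    using assms(1) by (auto simp: row_length_def r)
  then show ?thesis using part_ge_iff[OF assms(3,4)] by simp
qed

text \<open>The Durfee height \<open>d\<close> is the largest \<open>t\<close> with
  \<open>t \<le> c t\<close>, and the condition on the rows below it says \<open>c d = d\<close>.
  Any fixed point \<open>t\<close> forces this, since \<open>t \<le> d\<close> gives
  \<open>d \<le> c d \<le> c t = t\<close>.\<close>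

lemma durfee_condition_iff:
  assumes "a < m" "\<forall>p \<in># P. [p = a] (mod m)"
  shows "(\<forall>i. durfee_height a m \<nu> P < i \<and> i \<le> size P \<longrightarrow>
            row_length a m P i < durfee_height a m \<nu> P + \<nu> + 2)
    \<longleftrightarrow> (\<exists>t. size {#p \<in># P. a + m * (t + \<nu> + 1) \<le> p#} = t)"
proof -
  define c where "c t = size {#p \<in># P. a + m * (t + \<nu> + 1) \<le> p#}" for t
  have c_le: "c t \<le> size P" for t
    by (simp add: c_def size_mset_mono)
  have c_mono: "c t' \<le> c t" if "t \<le> t'" for t t'
  proof -
    have "a + m * (t + \<nu> + 1) \<le> a + m * (t' + \<nu> + 1)" using that by simp
    then show ?thesis unfolding c_def
      by (intro size_mset_mono filter_mset_mono_strong subset_mset.order_refl) (rule order_trans)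
  qed
  have row: "t + \<nu> + 1 < row_length a m P i \<longleftrightarrow> i \<le> c t" if "1 \<le> i" "i \<le> size P" for t i
    unfolding c_def using row_length_gt_iff[OF assms that] .
  define d where "d = durfee_height a m \<nu> P"
  have "{t. t \<le> size P \<and> (t = 0 \<or> row_length a m P t \<ge> t + \<nu> + 2)} = {t. t \<le> c t}" (is "?T = _")
  proof (intro set_eqI)
    fix t
    show "t \<in> ?T \<longleftrightarrow> t \<in> {t. t \<le> c t}"
      using row[of t t] c_le[of t] by (cases "t = 0") auto
  qed
  then have d: "d = Max {t. t \<le> c t}"
    by (simp add: d_def durfee_height_def)
  have "{t. t \<le> c t} \<subseteq> {..size P}" using c_le order_trans by blast
  then have fin: "finite {t. t \<le> c t}" by (rule finite_subset) simp
  have d_le: "d \<le> c d" using Max_in[OF fin] unfolding d by fastforce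
  have d_max: "t \<le> d" if "t \<le> c t" for t using Max_ge[OF fin] that unfolding d by simp
  have "(\<forall>i. d < i \<and> i \<le> size P \<longrightarrow> row_length a m P i < d + \<nu> + 2)
      \<longleftrightarrow> (\<forall>i. d < i \<and> i \<le> size P \<longrightarrow> \<not> i \<le> c d)"
  proof -
    have "row_length a m P i < d + \<nu> + 2 \<longleftrightarrow> \<not> i \<le> c d" if "d < i" "i \<le> size P" for i
      using row[of i d] that by auto
    then show ?thesis by blast
  qed
  \<comment> \<open>If \<open>d < c d\<close>, the index \<open>i = c d\<close> is itself a
    violating row, as \<open>c d \<le> size P\<close>.\<close>
  also have "\<dots> \<longleftrightarrow> c d = d"
    using d_le c_le[of d] by (metis le_neq_implies_less not_le order_refl)
  also have "\<dots> \<longleftrightarrow> (\<exists>t. c t = t)"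
  proof
    assume "\<exists>t. c t = t"
    then obtain t where t: "c t = t" by blast
    then have "c d \<le> t" using c_mono[of t d] d_max[of t] by simp
    then show "c d = d" using d_le t d_max[of t] by simp
  qed blast
  finally show ?thesis unfolding c_def d_def .
qed

text \<open>The parts in the other residue class are free, and \<open>n - \<alpha>\<close> is an
  exact subtraction, so everything becomes a condition on \<open>P\<close> alone.\<close>

lemma p_o4_eq:
  assumes "a < 4"
  shows "p_o4 a \<nu> n = card {P \<in> odd_partitions n. (\<forall>j \<le> \<nu>. a + 4 * j \<in># P) \<and>
     (\<exists>t. size {#p \<in># P. p mod 4 = a \<and> a + 4 * (t + \<nu> + 1) \<le> p#} = t)}"
proof -
  have "filter_mset (\<lambda>p. [p = a] (mod 4)) P
      \<in> M_partitions a 4 \<nu> (n - \<Sum>\<^sub># (filter_mset (\<lambda>p. \<not> [p = a] (mod 4)) P))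
    \<longleftrightarrow> (\<forall>j \<le> \<nu>. a + 4 * j \<in># P) \<and>
     (\<exists>t. size {#p \<in># P. p mod 4 = a \<and> a + 4 * (t + \<nu> + 1) \<le> p#} = t)" (is "?Q \<in> M_partitions _ _ _ ?k \<longleftrightarrow> _")
    if P: "P \<in> odd_partitions n" for P
  proof -
    have "?Q + filter_mset (\<lambda>p. \<not> [p = a] (mod 4)) P = P"
      by (rule multiset_partition[symmetric])
    then have "\<Sum>\<^sub># ?Q + \<Sum>\<^sub># (filter_mset (\<lambda>p. \<not> [p = a] (mod 4)) P) = n"
      using P by (metis (mono_tags, lifting) mem_Collect_eq odd_partitions_def partitions_of_def sum_mset.union)
    then have "?Q \<in> partitions_of ?k"
      using P by (auto simp: odd_partitions_def partitions_of_def)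
    moreover have "\<forall>p \<in># ?Q. [p = a] (mod 4)" by simp
    moreover have "[a + 4 * j = a] (mod 4)" for j by (simp add: cong_def)
    moreover have "[p = a] (mod 4) \<longleftrightarrow> p mod 4 = a" for p using assms by (simp add: cong_def)
    ultimately show ?thesis
      using durfee_condition_iff[OF assms, of ?Q \<nu>]
      by (simp add: M_partitions_def filter_filter_mset conj_commute)
  qed
  then show ?thesis unfolding p_o4_def Let_def by (intro arg_cong[of _ _ card] Collect_cong conj_cong) auto
qed

subsection \<open>Counting partitions into odd parts\<close>

declare of_nat_sum_mset [simp del]

text \<open>With integer arguments, negative ones count 0; natural subtraction would truncate them
  to 0, which has one partition.\<close>

definition odd_partitions_int :: "int \<Rightarrow> nat multiset set" where
  "odd_partitions_int z = {P. (\<forall>p \<in># P. odd p) \<and> int (\<Sum>\<^sub># P) = z}"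

definition p_o_int :: "int \<Rightarrow> nat" where
  "p_o_int z = card (odd_partitions_int z)"

lemma odd_partitions_int_of_nat: "odd_partitions_int (int n) = odd_partitions n"
  by (auto simp: odd_partitions_int_def odd_partitions_def partitions_of_def intro: Nat.gr0I)

lemma p_o_int_of_nat: "p_o_int (int n) = p_o n"
  by (simp add: p_o_int_def p_o_def odd_partitions_int_of_nat)

lemma p_o_int_neg: "z < 0 \<Longrightarrow> p_o_int z = 0"
  by (auto simp: p_o_int_def odd_partitions_int_def)

lemma size_le_sum_mset:
  fixes P :: "nat multiset"
  assumes "\<forall>p \<in># P. 0 < p"
  shows "size P \<le> \<Sum>\<^sub># P"
  using assms
proof (induction P)
  case (add x P)
  then have "size P \<le> \<Sum>\<^sub># P" "0 < x" by auto
  then show ?case by simp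
qed simp

lemma finite_partitions_of: "finite (partitions_of n)"
proof -
  have "partitions_of n \<subseteq> mset ` {xs. set xs \<subseteq> {..n} \<and> length xs \<le> n}"
  proof
    fix P assume P: "P \<in> partitions_of n"
    have "set_mset P \<subseteq> {..n}"
      using P by (auto simp: partitions_of_def dest!: multi_member_split)
    moreover have "size P \<le> n" using P size_le_sum_mset by (auto simp: partitions_of_def)
    ultimately show "P \<in> mset ` {xs. set xs \<subseteq> {..n} \<and> length xs \<le> n}"
      by (intro image_eqI[of _ _ "sorted_list_of_multiset P"]) (auto simp: size_mset[symmetric] simp del: size_mset)
  qed
  then show ?thesis
    by (rule finite_subset) (intro finite_imageI finite_lists_length_le finite_atMost)
qed

lemma finite_odd_partitions: "finite (odd_partitions n)"
  using finite_partitions_of by (rule finite_subset[rotated]) (auto simp: odd_partitions_def)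

lemma finite_odd_partitions_int: "finite (odd_partitions_int z)"
proof (cases "z < 0")
  case True
  then have "odd_partitions_int z = {}" by (auto simp: odd_partitions_int_def)
  then show ?thesis by simp
next
  case False
  then show ?thesis using finite_odd_partitions[of "nat z"] odd_partitions_int_of_nat[of "nat z"] by simp
qed

lemma card_eq_sum_card_fibres:
  assumes "finite S" "finite T" "g ` S \<subseteq> T"
  shows "card S = (\<Sum>y \<in> T. card {x \<in> S. g x = y})"
  using sum.group[OF assms, of "\<lambda>_. 1::nat"] by simp

lemma mset_set_subseteq_iff:
  assumes "finite A"
  shows "mset_set A \<subseteq># P \<longleftrightarrow> A \<subseteq> set_mset P"
proof
  assume "A \<subseteq> set_mset P"
  then show "mset_set A \<subseteq># P"
    by (meson finite_set_mset mset_set_set_mset_msubset subset_imp_msubset_mset_set subset_mset.trans)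
qed (use assms set_mset_mono in fastforce)

text \<open>Remove one copy of each prescribed part; these copies sum to
  \<open>(\<nu> + 1) * (2 * \<nu> + a)\<close>.\<close>

lemma card_odd_partitions_containing:
  assumes "odd a"
  shows "card {P \<in> odd_partitions n. \<forall>j \<le> \<nu>. a + 4 * j \<in># P}
    = p_o_int (int n - int ((\<nu> + 1) * (2 * \<nu> + a)))"
proof -
  define A where "A = (\<lambda>j. a + 4 * j) ` {..\<nu>}"
  define S where "S = mset_set A"
  have "\<Sum>A = (\<Sum>j \<le> \<nu>. a + 4 * j)"
    unfolding A_def by (subst sum.reindex) (auto simp: inj_on_def)
  also have "\<dots> = (\<nu> + 1) * (2 * \<nu> + a)"
    by (induction \<nu>) (auto simp: algebra_simps)
  finally have sum: "\<Sum>\<^sub># S = (\<nu> + 1) * (2 * \<nu> + a)"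
    by (simp add: S_def sum_unfold_sum_mset)
  have "finite A" by (simp add: A_def)
  then have sub: "(\<forall>j \<le> \<nu>. a + 4 * j \<in># P) \<longleftrightarrow> S \<subseteq># P" for P
    by (auto simp: S_def mset_set_subseteq_iff A_def)
  have odd: "\<forall>p \<in># S. odd p" using assms by (auto simp: S_def A_def)
  have "bij_betw (\<lambda>P. P - S) {P \<in> odd_partitions n. S \<subseteq># P}
     (odd_partitions_int (int n - int (\<Sum>\<^sub># S)))"
  proof (rule bij_betw_byWitness[where f' = "\<lambda>P. P + S"])
    show "(\<lambda>P. P - S) ` {P \<in> odd_partitions n. S \<subseteq># P} \<subseteq> odd_partitions_int (int n - int (\<Sum>\<^sub># S))"
    proof (rule image_subsetI)
      fix P assume P: "P \<in> {P \<in> odd_partitions n. S \<subseteq># P}"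
      then have "\<Sum>\<^sub># (P - S) + \<Sum>\<^sub># S = n"
        by (auto simp: odd_partitions_def partitions_of_def simp flip: sum_mset.union)
      with P show "P - S \<in> odd_partitions_int (int n - int (\<Sum>\<^sub># S))"
        by (auto simp: odd_partitions_int_def odd_partitions_def dest: in_diffD)
    qed
    show "(\<lambda>P. P + S) ` odd_partitions_int (int n - int (\<Sum>\<^sub># S)) \<subseteq> {P \<in> odd_partitions n. S \<subseteq># P}"
    proof (rule image_subsetI)
      fix P assume P: "P \<in> odd_partitions_int (int n - int (\<Sum>\<^sub># S))"
      then have "int (\<Sum>\<^sub># (P + S)) = int n" by (simp add: odd_partitions_int_def)
      moreover have "\<forall>p \<in># P + S. odd p" using P odd by (auto simp: odd_partitions_int_def)
      ultimately have "P + S \<in> odd_partitions_int (int n)"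
        unfolding odd_partitions_int_def by blast
      then show "P + S \<in> {P \<in> odd_partitions n. S \<subseteq># P}"
        by (simp add: odd_partitions_int_of_nat)
    qed
  qed simp_all
  then show ?thesis
    unfolding sub p_o_int_def sum[symmetric] by (rule bij_betw_same_card)
qed

subsection \<open>Raising the truncation order\<close>

text \<open>The least \<open>t\<close> with \<open>c t \<le> t\<close> exists because
  \<open>c 0\<close> qualifies; without a fixed point, its predecessor is where \<open>c\<close>
  jumps across the diagonal.\<close>

lemma antimono_no_fixpoint_iff:
  fixes c :: "nat \<Rightarrow> nat"
  assumes "antimono c"
  shows "(\<nexists>t. c t = t) \<longleftrightarrow> (\<exists>t. c (Suc t) \<le> t \<and> t < c t)"
proof
  assume nofix: "\<nexists>t. c t = t"
  have "c (c 0) \<le> c 0" using assms by (simp add: antimonoD)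
  then have "c (LEAST t. c t \<le> t) \<le> (LEAST t. c t \<le> t)" (is "c ?l \<le> ?l") by (rule LeastI)
  then have less: "c ?l < ?l" using nofix le_neq_implies_less by blast
  then obtain s where s: "?l = Suc s" using not0_implies_Suc by fastforce
  then have "\<not> c s \<le> s" using not_less_Least[of s "\<lambda>t. c t \<le> t"] by simp
  then have "c (Suc s) \<le> s \<and> s < c s" using less s by simp
  then show "\<exists>t. c (Suc t) \<le> t \<and> t < c t" ..
next
  assume "\<exists>t. c (Suc t) \<le> t \<and> t < c t"
  then obtain t where t: "c (Suc t) \<le> t" "t < c t" by blast
  have "c u \<noteq> u" for u
  proof (cases "u \<le> t")
    case True
    then show ?thesis using antimonoD[OF assms True] t by linarith
  next
    case False
    then have "c u \<le> c (Suc t)" using antimonoD[OF assms] by simp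
    then show ?thesis using False t by linarith
  qed
  then show "\<nexists>t. c t = t" by blast
qed

lemma card_Collect_Ex_unique:
  assumes "finite Y"
    and "\<And>P t. P \<in> Y \<Longrightarrow> R P t \<Longrightarrow> t \<le> n"
    and "\<And>P t t'. P \<in> Y \<Longrightarrow> R P t \<Longrightarrow> R P t' \<Longrightarrow> t = t'"
  shows "card {P \<in> Y. \<exists>t::nat. R P t} = (\<Sum>t \<le> n. card {P \<in> Y. R P t})"
proof -
  have "{P \<in> Y. \<exists>t. R P t} = (\<Union>t \<in> {..n}. {P \<in> Y. R P t})" using assms(2) by blast
  moreover have "card (\<Union>t \<in> {..n}. {P \<in> Y. R P t}) = (\<Sum>t \<le> n. card {P \<in> Y. R P t})"
    using assms(1,3) by (intro card_UN_disjoint) auto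
  ultimately show ?thesis by simp
qed

text \<open>For \<open>w = a + 4 * k\<close>, its size is the height of column \<open>k + 1\<close>
  in the 4-modular diagram of the parts in class \<open>a\<close>.\<close>

definition tail_mset :: "nat \<Rightarrow> nat \<Rightarrow> nat multiset \<Rightarrow> nat multiset" where
  "tail_mset a w P = {#p \<in># P. p mod 4 = a \<and> w \<le> p#}"

lemma tail_mset_union: "tail_mset a w (P + Q) = tail_mset a w P + tail_mset a w Q"
  by (simp add: tail_mset_def)

lemma tail_mset_diff: "tail_mset a w (P - Q) = tail_mset a w P - tail_mset a w Q"
  by (simp add: tail_mset_def)

lemma tail_mset_id: "(\<And>p. p \<in># P \<Longrightarrow> p mod 4 = a \<and> w \<le> p) \<Longrightarrow> tail_mset a w P = P"
  by (simp add: tail_mset_def filter_mset_eq_conv)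

lemma tail_mset_empty: "(\<And>p. p \<in># P \<Longrightarrow> p < w) \<Longrightarrow> tail_mset a w P = {#}"
  by (force simp: tail_mset_def)

lemma tail_mset_subset: "tail_mset a w P \<subseteq># P"
  by (simp add: tail_mset_def)

lemma in_tail_mset: "p \<in># tail_mset a w P \<longleftrightarrow> p \<in># P \<and> p mod 4 = a \<and> w \<le> p"
  by (simp add: tail_mset_def)

lemma tail_mset_split:
  assumes "v mod 4 = a"
  shows "tail_mset a v P = tail_mset a (v + 4) P + replicate_mset (count P v) v"
proof -
  have "v + 4 \<le> p" if "p mod 4 = v mod 4" "v < p" for p
  proof -
    have "4 dvd p - v" using that mod_eq_dvd_iff_nat[of v p 4] by simp
    then show ?thesis using that dvd_imp_le[of 4 "p - v"] by simp
  qed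
  then have "p mod 4 = a \<and> v \<le> p \<longleftrightarrow> p mod 4 = a \<and> v + 4 \<le> p \<or> p = v" for p
    using assms by (auto simp: le_less)
  then have "tail_mset a v P = {#p \<in># P. p mod 4 = a \<and> v + 4 \<le> p \<or> p = v#}"
    by (simp add: tail_mset_def)
  also have "\<dots> = tail_mset a (v + 4) P + {#p \<in># P. p = v#}"
    by (auto simp: tail_mset_def multiset_eq_iff)
  finally show ?thesis by (simp add: filter_eq_replicate_mset)
qed

lemma odd_partitions_iff: "P \<in> odd_partitions n \<longleftrightarrow> (\<forall>p \<in># P. odd p) \<and> \<Sum>\<^sub># P = n"
  by (auto simp: odd_partitions_def partitions_of_def intro: Nat.gr0I)

lemma size_tail_mset_le:
  assumes "P \<in> odd_partitions n"
  shows "size (tail_mset a w P) \<le> n"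
proof -
  have "size (tail_mset a w P) \<le> size P" by (simp add: tail_mset_subset size_mset_mono)
  also have "\<dots> \<le> n"
    using assms size_le_sum_mset[of P] by (auto simp: odd_partitions_def partitions_of_def)
  finally show ?thesis .
qed

lemma sum_mset_map_add: "\<Sum>\<^sub># (image_mset (\<lambda>p. p + k) J) = \<Sum>\<^sub># J + k * size (J :: nat multiset)"
  by (induction J) auto

text \<open>The bijection for a fixed crossing \<open>t\<close>. Lowering \<open>v\<close> to
  \<open>u\<close> loses \<open>4 * t\<close>, which is regained by adding 4 to each of
  \<open>t\<close> parts.\<close>

lemma card_shift_durfee:
  fixes a \<nu> t n :: nat
  assumes a: "a < 4" "odd a"
  defines "u \<equiv> a + 4 * (\<nu> + 1)"
  defines "v \<equiv> u + 4 * t"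
  shows "card {P \<in> odd_partitions n. (\<forall>j \<le> \<nu>. a + 4 * j \<in># P) \<and>
            size (tail_mset a (v + 4) P) \<le> t \<and> t < size (tail_mset a v P)}
       = card {P \<in> odd_partitions n. (\<forall>j \<le> \<nu>. a + 4 * j \<in># P) \<and> u \<in># P \<and>
            size (tail_mset a (v + 4) P) = t}" (is "card ?X = card ?Z")
proof -
  \<comment> \<open>Both sides are parametrised by the \<open>t\<close> large parts \<open>J\<close> and the remaining parts \<open>L\<close>,
    once the part \<open>v\<close> (resp. \<open>u\<close>) has been set aside.\<close>
  define C where "C = {(J, L). size J = t \<and> (\<forall>p \<in># J. p mod 4 = a \<and> v \<le> p) \<and>
    tail_mset a (v + 4) L = {#} \<and> (\<forall>j \<le> \<nu>. a + 4 * j \<in># L) \<and> (\<forall>p \<in># L. odd p) \<and>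
    \<Sum>\<^sub># J + \<Sum>\<^sub># L + v = n}"
  define f where "f = (\<lambda>(J, L). J + L + {#v#})"
  define g where "g = (\<lambda>(J, L). image_mset (\<lambda>p. p + 4) J + L + {#u#})"
  have v: "v mod 4 = a" "u mod 4 = a" "u \<le> v" "odd v" "odd u"
    using a unfolding v_def u_def by presburger+
  have odd: "odd p" if "p mod 4 = a" for p
    using a that by presburger
  have small: "a + 4 * j < u" if "j \<le> \<nu>" for j using that by (simp add: u_def)
  \<comment> \<open>Given its size, \<open>J\<close> is determined by its parts above
    \<open>v\<close>, the others being copies of \<open>v\<close>. This yields injectivity of
    \<open>f\<close>.\<close>
  have Jid: "J = tail_mset a (v + 4) J + replicate_mset (size J - size (tail_mset a (v + 4) J)) v"
    if J: "\<forall>p \<in># J. p mod 4 = a \<and> v \<le> p" for J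
  proof -
    have "J = tail_mset a v J" using J by (simp add: tail_mset_id)
    then have *: "J = tail_mset a (v + 4) J + replicate_mset (count J v) v"
      using tail_mset_split[OF v(1), of J] by simp
    then have "size J = size (tail_mset a (v + 4) J) + count J v"
      by (metis size_replicate_mset size_union)
    then show ?thesis using * by simp
  qed
  have tail_v: "tail_mset a (v + 4) (add_mset v M) = tail_mset a (v + 4) M"
    "tail_mset a (v + 4) (add_mset u M) = tail_mset a (v + 4) M"
    "tail_mset a v (add_mset v M) = add_mset v (tail_mset a v M)" for M
    using v by (auto simp: tail_mset_def)
  have f: "bij_betw f C ?X"
  proof (rule bij_betw_imageI)
    show "inj_on f C"
    proof (rule inj_onI)
      fix x y assume x: "x \<in> C" and y: "y \<in> C" and eq: "f x = f y"
      obtain J L J' L' where xy: "x = (J, L)" "y = (J', L')" by fastforce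
      have "tail_mset a (v + 4) (f x) = tail_mset a (v + 4) J"
        "tail_mset a (v + 4) (f y) = tail_mset a (v + 4) J'"
        using x y xy tail_v by (auto simp: f_def C_def tail_mset_union)
      then have "tail_mset a (v + 4) J = tail_mset a (v + 4) J'" using eq by simp
      then have "J = J'" using Jid[of J] Jid[of J'] x y xy by (auto simp: C_def)
      then show "x = y" using eq xy by (simp add: f_def)
    qed
    show "f ` C = ?X"
    proof (intro equalityI image_subsetI subsetI)
      fix x assume x: "x \<in> C"
      obtain J L where xy: "x = (J, L)" by fastforce
      have "tail_mset a (v + 4) (f x) = tail_mset a (v + 4) J"
        using x xy tail_v by (auto simp: f_def C_def tail_mset_union)
      then have "size (tail_mset a (v + 4) (f x)) \<le> t"
        using x xy size_mset_mono[OF tail_mset_subset[of a "v+4" J]] by (simp add: C_def)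
      moreover have "tail_mset a v (f x) = J + {#v#} + tail_mset a v L"
        using x xy tail_v tail_mset_id[of J a v]
        by (auto simp: f_def C_def tail_mset_union)
      then have "t < size (tail_mset a v (f x))" using x xy by (simp add: C_def)
      ultimately show "f x \<in> ?X" using x xy v odd
        by (auto simp: f_def C_def odd_partitions_iff)
    next
      fix P assume P: "P \<in> ?X"
      \<comment> \<open>To invert \<open>f\<close>, take the at most \<open>t\<close> parts above
        \<open>v\<close> and fill up to \<open>t\<close> parts with \<open>e\<close> copies of
        \<open>v\<close>. Since more than \<open>t\<close> parts are \<ge> \<open>v\<close>, another
        copy of \<open>v\<close> is left to set aside.\<close>
      define H where "H = tail_mset a (v + 4) P"
      define e where "e = t - size H"
      define J where "J = H + replicate_mset e v"
      define L where "L = P - (J + {#v#})"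
      have tail_eq: "tail_mset a v P = H + replicate_mset (count P v) v"
        unfolding H_def by (rule tail_mset_split[OF v(1)])
      then have "Suc e \<le> count P v" using P by (auto simp: e_def H_def)
      then have "replicate_mset (Suc e) v \<subseteq># replicate_mset (count P v) v"
        by (intro mset_subset_eqI) simp
      then have "J + {#v#} \<subseteq># tail_mset a v P"
        unfolding tail_eq J_def by (simp add: ac_simps)
      then have sub: "J + {#v#} \<subseteq># P" using tail_mset_subset subset_mset.trans by blast
      then have "P = (J + {#v#}) + L"
        unfolding L_def by (rule subset_mset.add_diff_inverse[symmetric])
      then have PJL: "P = J + L + {#v#}" by simp
      have J: "\<forall>p \<in># J. p mod 4 = a \<and> v \<le> p"
        using v by (auto simp: J_def H_def in_tail_mset split: if_splits)
      have sizeJ: "size J = t" using P by (simp add: J_def e_def H_def)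
      have "tail_mset a (v + 4) (replicate_mset e v) = {#}"
        by (rule tail_mset_empty) (simp split: if_splits)
      moreover have "tail_mset a (v + 4) H = H"
        by (rule tail_mset_id) (simp add: H_def in_tail_mset)
      ultimately have "tail_mset a (v + 4) (J + {#v#}) = H"
        using tail_v by (simp add: J_def tail_mset_union)
      then have "tail_mset a (v + 4) L = {#}"
        unfolding L_def tail_mset_diff H_def[symmetric] by simp
      moreover have "a + 4 * j \<in># L" if "j \<le> \<nu>" for j
      proof -
        have "a + 4 * j \<in># P" using P that by simp
        \<comment> \<open>The prescribed parts lie below \<open>u\<close>, hence below everything
          removed from \<open>P\<close>.\<close>
        moreover have "a + 4 * j \<notin># J" "a + 4 * j \<noteq> v" using J small[OF that] v(3) by fastforce+
        ultimately show ?thesis unfolding PJL by simp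
      qed
      moreover have "\<Sum>\<^sub># J + \<Sum>\<^sub># L + v = n" "\<forall>p \<in># L. odd p"
        using P PJL by (auto simp: odd_partitions_iff)
      ultimately have "(J, L) \<in> C" using J sizeJ by (simp add: C_def)
      moreover have "P = f (J, L)" using PJL by (simp add: f_def)
      ultimately show "P \<in> f ` C" by blast
    qed
  qed
  have g: "bij_betw g C ?Z"
  proof (rule bij_betw_imageI)
    have tail_g: "tail_mset a (v + 4) (g (J, L)) = image_mset (\<lambda>p. p + 4) J" if "(J, L) \<in> C" for J L
    proof -
      have "tail_mset a (v + 4) (image_mset (\<lambda>p. p + 4) J) = image_mset (\<lambda>p. p + 4) J"
        using that by (intro tail_mset_id) (auto simp: C_def)
      then show ?thesis using that tail_v by (simp add: g_def C_def tail_mset_union)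
    qed
    have inj: "inj (image_mset (\<lambda>p::nat. p + 4))"
      by (rule multiset.inj_map) (simp add: inj_def)
    show "inj_on g C"
    proof (rule inj_onI)
      fix x y assume x: "x \<in> C" and y: "y \<in> C" and eq: "g x = g y"
      obtain J L J' L' where xy: "x = (J, L)" "y = (J', L')" by fastforce
      have "image_mset (\<lambda>p. p + 4) J = image_mset (\<lambda>p. p + 4) J'"
        using tail_g x y xy eq by metis
      then have "J = J'" using inj by (simp add: inj_eq)
      then show "x = y" using eq xy by (simp add: g_def)
    qed
    show "g ` C = ?Z"
    proof (intro equalityI image_subsetI subsetI)
      fix x assume x: "x \<in> C"
      obtain J L where xy: "x = (J, L)" by fastforce
      have "\<Sum>\<^sub># (g x) = \<Sum>\<^sub># J + \<Sum>\<^sub># L + v"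
        using x xy by (simp add: g_def C_def sum_mset_map_add v_def)
      then show "g x \<in> ?Z" using x xy v odd tail_g[of J L]
        by (auto simp: g_def C_def odd_partitions_iff)
    next
      fix P assume P: "P \<in> ?Z"
      define K where "K = tail_mset a (v + 4) P"
      define J where "J = image_mset (\<lambda>p. p - 4) K"
      define L where "L = P - (K + {#u#})"
      \<comment> \<open>As \<open>u\<close> lies below all of \<open>K\<close>, removing both
        \<open>K\<close> and one copy of \<open>u\<close> is possible.\<close>
      have uK: "u \<notin># K" using v(3) by (simp add: K_def in_tail_mset)
      have "K + {#u#} \<subseteq># P"
      proof (rule mset_subset_eqI)
        fix p
        show "count (K + {#u#}) p \<le> count P p"
          using uK P mset_subset_eq_count[OF tail_mset_subset[of a "v+4" P], of p]
          by (auto simp: K_def not_in_iff)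
      qed
      then have "P = (K + {#u#}) + L"
        unfolding L_def by (rule subset_mset.add_diff_inverse[symmetric])
      then have PKL: "P = K + L + {#u#}" by simp
      have K: "\<forall>p \<in># K. p mod 4 = a \<and> v + 4 \<le> p" by (simp add: K_def in_tail_mset)
      then have KJ: "image_mset (\<lambda>p. p + 4) J = K"
        unfolding J_def image_mset.compositionality
        by (subst image_mset_cong[where g = id]) auto
      have "(p - 4) mod 4 = a \<and> v \<le> p - 4" if "p \<in># K" for p
        using K that le_mod_geq[of 4 p] by force
      then have J: "\<forall>p \<in># J. p mod 4 = a \<and> v \<le> p" by (simp add: J_def)
      have sizeJ: "size J = t" using P by (simp add: J_def K_def)
      have "tail_mset a (v + 4) K = K" using K by (intro tail_mset_id) simp
      then have "tail_mset a (v + 4) (K + {#u#}) = K"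
        using tail_v by (simp add: tail_mset_union)
      then have "tail_mset a (v + 4) L = {#}"
        unfolding L_def tail_mset_diff K_def[symmetric] by simp
      moreover have "a + 4 * j \<in># L" if "j \<le> \<nu>" for j
      proof -
        have "a + 4 * j \<in># P" using P that by simp
        moreover have "a + 4 * j \<notin># K" "a + 4 * j \<noteq> u" using K small[OF that] v(3) by fastforce+
        ultimately show ?thesis unfolding PKL by simp
      qed
      moreover have "\<Sum>\<^sub># K = \<Sum>\<^sub># J + 4 * t"
        unfolding KJ[symmetric] sum_mset_map_add sizeJ ..
      then have "\<Sum>\<^sub># J + \<Sum>\<^sub># L + v = n" "\<forall>p \<in># L. odd p"
        using P PKL by (auto simp: odd_partitions_iff v_def)
      ultimately have "(J, L) \<in> C" using J sizeJ by (simp add: C_def)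
      moreover have "P = g (J, L)" using PKL KJ by (simp add: g_def)
      ultimately show "P \<in> g ` C" by blast
    qed
  qed
  show ?thesis using bij_betw_same_card[OF f] bij_betw_same_card[OF g] by (rule trans[OF sym])
qed

text \<open>Partitions in \<open>Y\<close> with a fixed point are counted by the first summand;
  those with a jump are matched, crossing by crossing, with the ones counted by the second.\<close>

lemma p_o4_add_Suc:
  assumes a: "a < 4" "odd a"
  shows "p_o4 a \<nu> n + p_o4 a (Suc \<nu>) n = p_o_int (int n - int ((\<nu> + 1) * (2 * \<nu> + a)))"
proof -
  define c where "c P t = size (tail_mset a (a + 4 * (t + \<nu> + 1)) P)" for P t
  define Y where "Y = {P \<in> odd_partitions n. \<forall>j \<le> \<nu>. a + 4 * j \<in># P}"
  have fin: "finite Y" using finite_odd_partitions by (simp add: Y_def)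
  have anti: "antimono (c P)" for P
    unfolding c_def tail_mset_def
    by (intro antimonoI size_mset_mono filter_mset_mono_strong) auto
  have c_le: "c P t \<le> n" if "P \<in> Y" for P t
    using that size_tail_mset_le by (simp add: c_def Y_def)
  \<comment> \<open>For uniqueness of the crossing: a later one \<open>t'\<close> would give
    \<open>t' < c P t' \<le> c P (Suc t) \<le> t\<close>.\<close>
  have Suc_le: "t' \<le> t \<or> c P t' \<le> c P (Suc t)" for P t t'
    using antimonoD[OF anti, of "Suc t" t' P] by linarith
  define B where "B = {P \<in> Y. \<exists>t. c P (Suc t) \<le> t \<and> t < c P t}"
  \<comment> \<open>The column function for \<open>Suc \<nu>\<close> at \<open>t\<close> is that for
    \<nu> at \<open>Suc t\<close>.\<close>
  define B' where "B' = {P \<in> {P \<in> Y. a + 4 * Suc \<nu> \<in># P}. \<exists>t. c P (Suc t) = t}"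
  have nu: "p_o4 a \<nu> n = card {P \<in> Y. \<exists>t. c P t = t}"
    unfolding p_o4_eq[OF a(1)] by (simp add: c_def Y_def tail_mset_def)
  have Suc_nu: "p_o4 a (Suc \<nu>) n = card B'"
    unfolding p_o4_eq[OF a(1)] B'_def
    by (intro arg_cong[of _ _ card] Collect_cong) (auto simp: c_def Y_def tail_mset_def le_Suc_eq)
  have "Y = {P \<in> Y. \<exists>t. c P t = t} \<union> B"
    unfolding B_def using antimono_no_fixpoint_iff[OF anti] by blast
  moreover have "{P \<in> Y. \<exists>t. c P t = t} \<inter> B = {}"
    unfolding B_def using antimono_no_fixpoint_iff[OF anti] by blast
  ultimately have "card Y = p_o4 a \<nu> n + card B"
    using fin nu card_Un_disjoint[of "{P \<in> Y. \<exists>t. c P t = t}" B] by (simp add: B_def)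
  moreover have "card B = (\<Sum>t \<le> n. card {P \<in> Y. c P (Suc t) \<le> t \<and> t < c P t})"
    unfolding B_def
  proof (rule card_Collect_Ex_unique[OF fin])
    fix P t t'
    assume "c P (Suc t) \<le> t \<and> t < c P t" "c P (Suc t') \<le> t' \<and> t' < c P t'"
    then show "t = t'" using Suc_le[of t' t P] Suc_le[of t t' P] by linarith
  next
    fix P t
    assume "P \<in> Y" "c P (Suc t) \<le> t \<and> t < c P t"
    then show "t \<le> n" using c_le[of P t] by linarith
  qed
  moreover have "card B' = (\<Sum>t \<le> n. card {P \<in> {P \<in> Y. a + 4 * Suc \<nu> \<in># P}. c P (Suc t) = t})"
    unfolding B'_def
  proof (rule card_Collect_Ex_unique)
    fix P t t'
    assume "c P (Suc t) = t" "c P (Suc t') = t'"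
    then show "t = t'"
      using Suc_le[of "Suc t'" t P] Suc_le[of "Suc t" t' P] by linarith
  next
    fix P t
    assume "P \<in> {P \<in> Y. a + 4 * Suc \<nu> \<in># P}" "c P (Suc t) = t"
    then show "t \<le> n" using c_le[of P "Suc t"] by simp
  qed (simp add: fin)
  moreover have "card {P \<in> Y. c P (Suc t) \<le> t \<and> t < c P t}
      = card {P \<in> {P \<in> Y. a + 4 * Suc \<nu> \<in># P}. c P (Suc t) = t}" for t
    using card_shift_durfee[OF a, of n \<nu> t]
    by (simp add: c_def Y_def algebra_simps conj_ac)
  ultimately have "p_o4 a \<nu> n + p_o4 a (Suc \<nu>) n = card Y" using Suc_nu by simp
  then show ?thesis
    unfolding Y_def card_odd_partitions_containing[OF a(2)] .
qed

text \<open>The count is a summand of a value of \<open>p_o_int\<close> at a negative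
  argument.\<close>

lemma p_o4_eq_0:
  assumes "a < 4" "odd a" "n \<le> \<nu>"
  shows "p_o4 a \<nu> n = 0"
proof -
  have "0 < a" using assms(2) by (cases a) auto
  then have "n < (\<nu> + 1) * (2 * \<nu> + a)" using assms(3) by (cases a) (auto simp: algebra_simps)
  then have "p_o_int (int n - int ((\<nu> + 1) * (2 * \<nu> + a))) = 0"
    by (intro p_o_int_neg) linarith
  then show ?thesis
    using p_o4_add_Suc[OF assms(1,2), of \<nu> n] by simp
qed

subsection \<open>Vanishing of the complete sum at odd arguments\<close>

definition weight :: "int set \<Rightarrow> int" where
  "weight E = (\<Sum>i \<in> E. \<bar>4 * i + 1\<bar>)"

text \<open>As \<open>\<bar>4 * i + 1\<bar>\<close> is 1 mod 4 for \<open>i \<ge> 0\<close> and 3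
  mod 4 for \<open>i < 0\<close>, this is the number of parts of the first class minus that of the
  second.\<close>

definition charge :: "int set \<Rightarrow> int" where
  "charge E = (\<Sum>i \<in> E. if 0 \<le> i then 1 else - 1)"

definition charged_sets :: "int \<Rightarrow> int \<Rightarrow> int set set" where
  "charged_sets c z = {E. finite E \<and> charge E = c \<and> weight E = z}"

lemma even_weight_add_charge: "finite E \<Longrightarrow> even (weight E + charge E)"
  by (induction E rule: finite_induct) (auto simp: weight_def charge_def)

lemma abs_charge_le_weight: "finite E \<Longrightarrow> \<bar>charge E\<bar> \<le> weight E"
  by (induction E rule: finite_induct) (auto simp: weight_def charge_def)

text \<open>A finite set \<open>E\<close> of integers records where a subset of \<open>\<int>\<close> differs from the negative
  integers; translating that subset by one changes \<open>E\<close> as follows.\<close>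

definition shift_charge :: "int set \<Rightarrow> int set" where
  "shift_charge E =
     (if - 1 \<in> E then (\<lambda>i. i + 1) ` (E - {- 1}) else insert 0 ((\<lambda>i. i + 1) ` E))"

definition unshift_charge :: "int set \<Rightarrow> int set" where
  "unshift_charge E =
     (if 0 \<in> E then (\<lambda>i. i - 1) ` (E - {0}) else insert (- 1) ((\<lambda>i. i - 1) ` E))"

lemma unshift_shift: "unshift_charge (shift_charge E) = E"
proof (cases "- 1 \<in> E")
  case True
  then have "0 \<notin> shift_charge E" by (auto simp: shift_charge_def)
  then show ?thesis using True
    by (auto simp: shift_charge_def unshift_charge_def image_image)
next
  case False
  then have "0 \<notin> (\<lambda>i. i + 1) ` E" by (auto simp: add_eq_0_iff2)
  then show ?thesis using False
    by (auto simp: shift_charge_def unshift_charge_def image_image)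
qed

lemma shift_unshift: "shift_charge (unshift_charge E) = E"
proof (cases "0 \<in> E")
  case True
  then have "- 1 \<notin> unshift_charge E" by (auto simp: unshift_charge_def)
  then show ?thesis using True
    by (auto simp: shift_charge_def unshift_charge_def image_image)
next
  case False
  then have "- 1 \<notin> (\<lambda>i. i - 1) ` E" by auto
  then show ?thesis using False
    by (auto simp: shift_charge_def unshift_charge_def image_image)
qed

lemma finite_shift: "finite (shift_charge E) \<longleftrightarrow> finite E"
proof -
  have "finite ((\<lambda>i. i + 1) ` F) \<longleftrightarrow> finite F" for F :: "int set"
    by (rule finite_image_iff) (simp add: inj_on_def)
  then show ?thesis by (simp add: shift_charge_def)
qed

text \<open>For \<open>i \<noteq> - 1\<close> the step to \<open>i + 1\<close> keeps the sign and
  changes the odd number by 4 times that sign.\<close>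

lemma charge_weight_translate:
  assumes "finite F" "- 1 \<notin> F"
  shows "charge ((\<lambda>i. i + 1) ` F) = charge F"
    and "weight ((\<lambda>i. i + 1) ` F) = weight F + 4 * charge F"
proof -
  have inj: "inj_on (\<lambda>i. i + 1) F" by (simp add: inj_on_def)
  have ne: "i \<noteq> - 1" if "i \<in> F" for i using assms that by blast
  have "charge ((\<lambda>i. i + 1) ` F) = (\<Sum>i \<in> F. if 0 \<le> i + 1 then 1 else - 1)"
    unfolding charge_def by (subst sum.reindex[OF inj]) simp
  also have "\<dots> = charge F"
    unfolding charge_def using ne by (intro sum.cong refl) force
  finally show "charge ((\<lambda>i. i + 1) ` F) = charge F" .
  have "weight ((\<lambda>i. i + 1) ` F) = (\<Sum>i \<in> F. \<bar>4 * (i + 1) + 1\<bar>)"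
    unfolding weight_def by (subst sum.reindex[OF inj]) simp
  also have "\<dots> = (\<Sum>i \<in> F. \<bar>4 * i + 1\<bar> + 4 * (if 0 \<le> i then 1 else - 1))"
    using ne by (intro sum.cong refl) force
  also have "\<dots> = weight F + 4 * charge F"
    by (simp only: weight_def charge_def sum.distrib sum_distrib_left)
  finally show "weight ((\<lambda>i. i + 1) ` F) = weight F + 4 * charge F" .
qed

text \<open>Deleting -1 removes weight 3 and charge -1; inserting 0 adds weight 1 and charge 1.
  Combined with the translation, both cases give the same increments.\<close>

lemma charge_weight_shift:
  assumes "finite E"
  shows "charge (shift_charge E) = charge E + 1"
    and "weight (shift_charge E) = weight E + 4 * charge E + 1"
proof -
  have "charge (shift_charge E) = charge E + 1 \<and>
    weight (shift_charge E) = weight E + 4 * charge E + 1"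
  proof (cases "- 1 \<in> E")
    case True
    define F where "F = E - {- 1}"
    have F: "finite F" "- 1 \<notin> F" "E = insert (- 1) F" using assms True by (auto simp: F_def)
    then have "charge E = charge F - 1" "weight E = weight F + 3"
      by (simp_all add: charge_def weight_def)
    then show ?thesis
      using True charge_weight_translate[OF F(1,2)] by (simp add: shift_charge_def flip: F_def)
  next
    case False
    then have "0 \<notin> (\<lambda>i. i + 1) ` E" by (auto simp: add_eq_0_iff2)
    then have "charge (insert 0 ((\<lambda>i. i + 1) ` E)) = charge ((\<lambda>i. i + 1) ` E) + 1"
      "weight (insert 0 ((\<lambda>i. i + 1) ` E)) = weight ((\<lambda>i. i + 1) ` E) + 1"
      using assms by (simp_all add: charge_def weight_def)
    then show ?thesis
      using False charge_weight_translate[OF assms False] by (simp add: shift_charge_def)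
  qed
  then show "charge (shift_charge E) = charge E + 1"
    and "weight (shift_charge E) = weight E + 4 * charge E + 1" by blast+
qed

lemma card_charged_sets_shift:
  "card (charged_sets (c + 1) (z + 4 * c + 1)) = card (charged_sets c z)"
proof -
  have "bij_betw shift_charge (charged_sets c z) (charged_sets (c + 1) (z + 4 * c + 1))"
  proof (rule bij_betw_byWitness[where f' = unshift_charge])
    show "shift_charge ` charged_sets c z \<subseteq> charged_sets (c + 1) (z + 4 * c + 1)"
      by (auto simp: charged_sets_def charge_weight_shift finite_shift)
    show "unshift_charge ` charged_sets (c + 1) (z + 4 * c + 1) \<subseteq> charged_sets c z"
    proof (rule image_subsetI)
      fix E assume E: "E \<in> charged_sets (c + 1) (z + 4 * c + 1)"
      then have "finite (unshift_charge E)"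
        using finite_shift[of "unshift_charge E"] by (simp add: shift_unshift charged_sets_def)
      then show "unshift_charge E \<in> charged_sets c z"
        using E charge_weight_shift[of "unshift_charge E"]
        by (simp add: shift_unshift charged_sets_def)
    qed
  qed (simp_all add: shift_unshift unshift_shift)
  then show ?thesis by (metis bij_betw_same_card)
qed

text \<open>The increment \<open>4 * c + 1\<close> is the first difference of
  \<open>2 * c * c - c\<close>, so induction in both directions reduces every charge to 0.\<close>

lemma card_charged_sets:
  "card (charged_sets c z) = card (charged_sets 0 (z - (2 * c * c - c)))"
proof (induction c arbitrary: z rule: int_induct[of _ 0])
  case base
  show ?case by simp
next
  case (step1 i)
  have "card (charged_sets (i + 1) z) = card (charged_sets i (z - 4 * i - 1))"
    using card_charged_sets_shift[of i "z - 4 * i - 1"] by simp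
  then show ?case using step1.IH[of "z - 4 * i - 1"] by (simp add: algebra_simps)
next
  case (step2 i)
  have "card (charged_sets (i - 1) z) = card (charged_sets i (z + 4 * (i - 1) + 1))"
    using card_charged_sets_shift[of "i - 1" z] by simp
  then show ?case using step2.IH[of "z + 4 * (i - 1) + 1"] by (simp add: algebra_simps)
qed

lemma charged_sets_0_odd: "odd z \<Longrightarrow> charged_sets 0 z = {}"
  using even_weight_add_charge by (fastforce simp: charged_sets_def)

section \<open>Odd partitions as a finite set plus a doubled partition\<close>

definition signed_odd :: "int \<Rightarrow> nat" where
  "signed_odd i = nat \<bar>4 * i + 1\<bar>"

lemma inj_signed_odd: "inj signed_odd"
proof (rule injI)
  fix i j assume "signed_odd i = signed_odd j"
  then have "\<bar>4 * i + 1\<bar> = \<bar>4 * j + 1\<bar>" by (simp add: signed_odd_def)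
  then show "i = j" by presburger
qed

lemma odd_signed_odd: "odd (signed_odd i)"
  by (simp add: signed_odd_def even_nat_iff)

lemma signed_odd_surj:
  assumes "odd p"
  obtains i where "signed_odd i = p"
proof -
  have "\<exists>q. p = 4 * q + 1 \<or> p = 4 * q + 3" using assms by presburger
  then obtain q where "p = 4 * q + 1 \<or> p = 4 * q + 3" ..
  then show thesis
  proof
    assume "p = 4 * q + 1"
    then have "signed_odd (int q) = p" by (simp add: signed_odd_def)
    then show thesis by (rule that)
  next
    assume "p = 4 * q + 3"
    then have "signed_odd (- int q - 1) = p" by (simp add: signed_odd_def)
    then show thesis by (rule that)
  qed
qed

lemma sum_mset_signed_odd:
  assumes "finite E"
  shows "int (\<Sum>\<^sub># (image_mset signed_odd (mset_set E))) = weight E"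
  unfolding sum_unfold_sum_mset[symmetric] by (simp add: weight_def signed_odd_def)

text \<open>\<open>E\<close> encodes the parts of odd multiplicity. Parts are added one at a time;
  one already in \<open>E\<close> forms a pair, which moves to \<open>R + R\<close>.\<close>

lemma odd_mset_decompose:
  assumes "\<forall>p \<in># P. odd p"
  shows "\<exists>E R. finite E \<and> (\<forall>p \<in># R. odd p) \<and> P = image_mset signed_odd (mset_set E) + R + R"
  using assms
proof (induction P)
  case empty
  have "{#} = image_mset signed_odd (mset_set {}) + {#} + {#}" by simp
  then show ?case by (metis empty_iff finite.emptyI set_mset_empty)
next
  case (add x P)
  then obtain E R where ER: "finite E" "\<forall>p \<in># R. odd p"
      "P = image_mset signed_odd (mset_set E) + R + R" by auto
  obtain i where i: "signed_odd i = x" using add.prems signed_odd_surj by auto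
  show ?case
  proof (cases "i \<in> E")
    case True
    then have "mset_set E = add_mset i (mset_set (E - {i}))"
      using ER(1) by (metis mset_set.remove)
    then have "add_mset x P = image_mset signed_odd (mset_set (E - {i})) + add_mset x R + add_mset x R"
      using ER(3) i by simp
    moreover have "finite (E - {i})" "\<forall>p \<in># add_mset x R. odd p" using ER add.prems by auto
    ultimately show ?thesis by blast
  next
    case False
    then have "add_mset x P = image_mset signed_odd (mset_set (insert i E)) + R + R"
      using ER(1,3) i by simp
    then show ?thesis using ER by (meson finite_insert)
  qed
qed

text \<open>Pairs \<open>(E, R)\<close> are grouped by the sum \<open>k\<close> of \<open>R\<close>
  and the charge \<open>c\<close> of \<open>E\<close>. The range depends only on an upper bound
  \<open>L\<close>, so that one range serves several \<open>z\<close> and sums can be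
  exchanged.\<close>

lemma p_o_int_eq_sum:
  assumes "z \<le> L"
  shows "p_o_int z
    = (\<Sum>k = 0..L. \<Sum>c = - L..L. card (charged_sets c (z - 2 * k)) * p_o_int k)"
proof -
  define S where "S = {(E, R). finite E \<and> (\<forall>p \<in># R. odd p) \<and> weight E + 2 * int (\<Sum>\<^sub># R) = z}"
  define h where "h = (\<lambda>(E, R). image_mset signed_odd (mset_set E) + R + R)"
  define g where "g = (\<lambda>(E, R :: nat multiset). (int (\<Sum>\<^sub># R), charge E))"
  have "bij_betw h S (odd_partitions_int z)"
  proof (rule bij_betw_imageI)
    \<comment> \<open>\<open>R + R\<close> contributes evenly and \<open>E\<close> at most once to
      each multiplicity, so parities recover \<open>E\<close>.\<close>
    have odd_count: "odd (count (h (E, R)) p) \<longleftrightarrow> p \<in> signed_odd ` E" if "finite E" for E R p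
      using that image_mset_mset_set[of signed_odd E] inj_signed_odd
      by (simp add: h_def inj_on_subset[of _ UNIV] count_mset_set')
    show "inj_on h S"
    proof (rule inj_onI)
      fix x y assume x: "x \<in> S" and y: "y \<in> S" and eq: "h x = h y"
      obtain E R E' R' where xy: "x = (E, R)" "y = (E', R')" by fastforce
      have "signed_odd ` E = signed_odd ` E'"
        using odd_count[of E R] odd_count[of E' R'] x y xy eq by (auto simp: S_def)
      then have E: "E = E'" using inj_signed_odd by (simp add: inj_image_eq_iff)
      then have "R + R = R' + R'" using eq xy by (simp add: h_def add.assoc)
      then have "count R p + count R p = count R' p + count R' p" for p by (metis count_union)
      then have "R = R'" by (intro multiset_eqI) (metis mult_2 mult_left_cancel zero_neq_numeral)
      with E xy show "x = y" by simp
    qed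
    show "h ` S = odd_partitions_int z"
    proof (intro equalityI image_subsetI subsetI)
      fix x assume "x \<in> S"
      then show "h x \<in> odd_partitions_int z"
        using sum_mset_signed_odd odd_signed_odd
        by (auto simp: S_def h_def odd_partitions_int_def)
    next
      fix P assume P: "P \<in> odd_partitions_int z"
      then obtain E R where ER: "finite E" "\<forall>p \<in># R. odd p" "P = h (E, R)"
        using odd_mset_decompose[of P] by (auto simp: odd_partitions_int_def h_def)
      then have "(E, R) \<in> S"
        using P sum_mset_signed_odd[OF ER(1)] by (simp add: S_def h_def odd_partitions_int_def)
      then show "P \<in> h ` S" using ER(3) by blast
    qed
  qed
  then have card: "p_o_int z = card S" and "finite S"
    using bij_betw_same_card[of h S] bij_betw_finite[of h S] finite_odd_partitions_int
    by (auto simp: p_o_int_def)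
  have "g ` S \<subseteq> {0..L} \<times> {- L..L}"
    using abs_charge_le_weight assms by (fastforce simp: S_def g_def abs_le_iff)
  then have "card S = (\<Sum>y \<in> {0..L} \<times> {- L..L}. card {x \<in> S. g x = y})"
    by (intro card_eq_sum_card_fibres \<open>finite S\<close>) auto
  also have "\<dots> = (\<Sum>(k, c) \<in> {0..L} \<times> {- L..L}. card (charged_sets c (z - 2 * k)) * p_o_int k)"
  proof (rule sum.cong[OF refl], clarify)
    fix k c
    have "{x \<in> S. g x = (k, c)} = charged_sets c (z - 2 * k) \<times> odd_partitions_int k"
    proof (rule set_eqI)
      fix x :: "int set \<times> nat multiset"
      obtain E R where x: "x = (E, R)" by fastforce
      show "x \<in> {x \<in> S. g x = (k, c)} \<longleftrightarrow> x \<in> charged_sets c (z - 2 * k) \<times> odd_partitions_int k"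
        unfolding x S_def g_def charged_sets_def odd_partitions_int_def mem_Collect_eq
          mem_Times_iff prod.case fst_conv snd_conv prod.inject by force
    qed
    then show "card {x \<in> S. g x = (k, c)} = card (charged_sets c (z - 2 * k)) * p_o_int k"
      by (simp add: card_cartesian_product p_o_int_def)
  qed
  finally show ?thesis using card by (simp add: sum.cartesian_product)
qed

section \<open>Cancellation by exchanging summation index and charge\<close>

definition parity_sign :: "int \<Rightarrow> int" where
  "parity_sign j = (if even j then 1 else - 1)"

lemma signed_sum_p_o_int_eq_0:
  assumes "odd N" "0 \<le> L" "N \<le> L"
  shows "(\<Sum>j = - L..L. parity_sign j * int (p_o_int (N - (2 * j * j - j)))) = 0"
proof -
  define D where "D z = int (card (charged_sets 0 z))" for z
  define G where "G j = 2 * j * j - j" for j :: int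
  have G_nonneg: "0 \<le> G j" for j
  proof -
    have "j \<le> j * j" by (cases "j \<le> 0") (auto simp: mult_le_cancel_left2 intro: order_trans)
    moreover have "0 \<le> j * j" by simp
    ultimately show ?thesis unfolding G_def by linarith
  qed
  have inner: "(\<Sum>j = - L..L. \<Sum>c = - L..L. parity_sign j * D (M - G j - G c)) = 0" (is "?W = 0")
    if "odd M" for M
  proof -
    \<comment> \<open>The argument of \<open>D\<close> is symmetric in \<open>j\<close> and
      \<open>c\<close>, so the sign may sit on either index.\<close>
    have "?W = (\<Sum>j = - L..L. \<Sum>c = - L..L. parity_sign c * D (M - G j - G c))"
      by (subst sum.swap) (simp add: algebra_simps)
    then have "?W + ?W = (\<Sum>j = - L..L. \<Sum>c = - L..L. (parity_sign j + parity_sign c) * D (M - G j - G c))"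
      by (simp add: sum.distrib distrib_right)
    also have "\<dots> = 0"
    proof (intro sum.neutral ballI)
      fix j c
      show "(parity_sign j + parity_sign c) * D (M - G j - G c) = 0"
      \<comment> \<open>Since \<open>G j + G c\<close> has the parity of \<open>j + c\<close>, an
        even \<open>j + c\<close> leaves an odd weight at charge 0, which is impossible; otherwise
        the signs cancel.\<close>
      proof (cases "even (j + c)")
        case True
        then have "odd (M - G j - G c)" using that by (auto simp: G_def)
        then show ?thesis by (simp add: D_def charged_sets_0_odd)
      next
        case False
        then show ?thesis by (auto simp: parity_sign_def)
      qed
    qed
    finally show ?thesis by simp
  qed
  have "(\<Sum>j = - L..L. parity_sign j * int (p_o_int (N - G j)))
      = (\<Sum>j = - L..L. \<Sum>k = 0..L. \<Sum>c = - L..L. int (p_o_int k) * (parity_sign j * D (N - 2 * k - G j - G c)))"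
  proof (rule sum.cong[OF refl])
    fix j
    have "N - G j \<le> L" using G_nonneg[of j] assms(3) by linarith
    then have "int (p_o_int (N - G j))
        = (\<Sum>k = 0..L. \<Sum>c = - L..L. int (card (charged_sets c (N - G j - 2 * k))) * int (p_o_int k))"
      by (subst p_o_int_eq_sum[of _ L]) simp_all
    also have "\<dots> = (\<Sum>k = 0..L. \<Sum>c = - L..L. int (p_o_int k) * D (N - 2 * k - G j - G c))"
      by (subst card_charged_sets) (simp add: D_def G_def algebra_simps)
    finally show "parity_sign j * int (p_o_int (N - G j))
      = (\<Sum>k = 0..L. \<Sum>c = - L..L. int (p_o_int k) * (parity_sign j * D (N - 2 * k - G j - G c)))"
      by (simp add: sum_distrib_left mult.left_commute)
  qed
  also have "\<dots> = (\<Sum>k = 0..L. int (p_o_int k) *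
      (\<Sum>j = - L..L. \<Sum>c = - L..L. parity_sign j * D (N - 2 * k - G j - G c)))"
    by (subst sum.swap) (simp add: sum_distrib_left)
  \<comment> \<open>\<open>N - 2 * k\<close> is odd for every \<open>k\<close>.\<close>
  also have "\<dots> = 0" using inner assms(1) by simp
  finally show ?thesis by (simp add: G_def)
qed

subsection \<open>The truncated sum\<close>

text \<open>Indices \<open>j = - \<tau>\<close> and \<open>j = \<tau> + 1\<close> turn
  \<open>j * (2 * j - 1)\<close> into the offsets of the two sums in the theorem.\<close>

lemma sum_int_symmetric_split:
  fixes F :: "int \<Rightarrow> 'a::comm_monoid_add"
  shows "(\<Sum>j = - int K..int K. F j) = (\<Sum>\<tau> = 0..K. F (- int \<tau>)) + (\<Sum>\<tau> < K. F (int \<tau> + 1))"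
proof (induction K)
  case (Suc K)
  have "{- int (Suc K)..int (Suc K)} = insert (- int (Suc K)) (insert (int K + 1) {- int K..int K})"
    by auto
  then have "(\<Sum>j = - int (Suc K)..int (Suc K). F j)
      = F (- int (Suc K)) + (F (int K + 1) + (\<Sum>j = - int K..int K. F j))"
    by simp
  then show ?case unfolding Suc.IH by (simp add: ac_simps)
qed simp

lemma truncated_sum_p_o_int:
  fixes N \<nu> :: nat
  assumes "odd N"
  defines "S \<equiv> \<lambda>\<nu>. (\<Sum>\<tau> = 0..\<nu>. (-1) ^ \<tau> * int (p_o_int (int N - int (\<tau> * (2 * \<tau> + 1)))))
       - (\<Sum>\<tau> < \<nu>. (-1) ^ \<tau> * int (p_o_int (int N - int ((\<tau> + 1) * (2 * \<tau> + 1)))))"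
  shows "S \<nu> = (-1) ^ \<nu> * (int (p_o4 3 \<nu> N) + int (p_o4 1 \<nu> N))"
proof -
  define G where "G \<nu> = int (p_o4 3 \<nu> N) + int (p_o4 1 \<nu> N)" for \<nu>
  \<comment> \<open>The new terms of the two sums are given by the recurrence for
    \<open>a = 3\<close> and \<open>a = 1\<close>. With the sign on the side of \<open>G\<close>,
    the difference is constant in \<nu>.\<close>
  have step: "S (Suc \<nu>) - (-1) ^ Suc \<nu> * G (Suc \<nu>) = S \<nu> - (-1) ^ \<nu> * G \<nu>" for \<nu>
  proof -
    have "int (p_o_int (int N - int ((\<nu> + 1) * (2 * \<nu> + 3)))) = int (p_o4 3 \<nu> N + p_o4 3 (Suc \<nu>) N)"
      "int (p_o_int (int N - int ((\<nu> + 1) * (2 * \<nu> + 1)))) = int (p_o4 1 \<nu> N + p_o4 1 (Suc \<nu>) N)"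
      using p_o4_add_Suc[of 3 \<nu> N] p_o4_add_Suc[of 1 \<nu> N] by simp_all
    moreover have "Suc \<nu> * (2 * Suc \<nu> + 1) = (\<nu> + 1) * (2 * \<nu> + 3)" by (simp add: algebra_simps)
    ultimately have "S (Suc \<nu>) = S \<nu> + (-1) ^ Suc \<nu> * int (p_o4 3 \<nu> N + p_o4 3 (Suc \<nu>) N)
        - (-1) ^ \<nu> * int (p_o4 1 \<nu> N + p_o4 1 (Suc \<nu>) N)"
      by (simp only: S_def sum.lessThan_Suc sum.atLeast0_atMost_Suc)
    then show ?thesis by (simp add: G_def algebra_simps)
  qed
  have const: "S (\<nu> + k) - (-1) ^ (\<nu> + k) * G (\<nu> + k) = S \<nu> - (-1) ^ \<nu> * G \<nu>" for k
  proof (induction k)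
    case (Suc k)
    then show ?case using step[of "\<nu> + k"] by simp
  qed simp
  \<comment> \<open>The order \<open>\<nu> + N\<close> is at least \<open>N\<close>, so that both
    the complete sum and \<open>G\<close> vanish there.\<close>
  have "(\<Sum>j = - int (\<nu> + N)..int (\<nu> + N). parity_sign j * int (p_o_int (int N - (2 * j * j - j)))) = 0"
    using assms(1) by (intro signed_sum_p_o_int_eq_0) auto
  moreover have "parity_sign (- int \<tau>) * int (p_o_int (int N - (2 * (- int \<tau>) * (- int \<tau>) - (- int \<tau>))))
      = (-1) ^ \<tau> * int (p_o_int (int N - int (\<tau> * (2 * \<tau> + 1))))" for \<tau>
    by (simp add: algebra_simps parity_sign_def)
  moreover have "parity_sign (int \<tau> + 1) * int (p_o_int (int N - (2 * (int \<tau> + 1) * (int \<tau> + 1) - (int \<tau> + 1))))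
      = - ((-1) ^ \<tau> * int (p_o_int (int N - int ((\<tau> + 1) * (2 * \<tau> + 1)))))" for \<tau>
    by (simp add: algebra_simps parity_sign_def)
  ultimately have "S (\<nu> + N) = 0"
    by (simp only: sum_int_symmetric_split S_def sum_negf diff_conv_add_uminus)
  moreover have "G (\<nu> + N) = 0"
    by (simp add: G_def p_o4_eq_0)
  ultimately show ?thesis using const[of N] by (simp add: G_def)
qed

theorem theorem1p5:
  fixes \<nu> n :: nat
  assumes "\<nu> \<ge> 1" and "n > \<nu> * (2 * \<nu> + 3)"
  shows "(-1) ^ \<nu> *
      ((\<Sum>\<tau> = 0..\<nu>. (-1) ^ \<tau> * int (p_o (2 * n + 1 - \<tau> * (2 * \<tau> + 1))))
       - (\<Sum>\<tau> = 0..\<nu> - 1. (-1) ^ \<tau> * int (p_o (2 * n + 1 - (\<tau> + 1) * (2 * \<tau> + 1)))))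
    = int (p_o4 3 \<nu> (2 * n + 1)) + int (p_o4 1 \<nu> (2 * n + 1))"
proof -
  let ?N = "2 * n + 1"
  \<comment> \<open>The bound on \<open>n\<close> keeps all arguments nonnegative, where natural and
    integer subtraction agree.\<close>
  have p_o: "p_o (?N - k) = p_o_int (int ?N - int k)" if "k \<le> ?N" for k
    using that p_o_int_of_nat[of "?N - k"] by (simp only: of_nat_diff)
  have "\<tau> * (2 * \<tau> + 1) \<le> ?N" if "\<tau> \<le> \<nu>" for \<tau>
  proof -
    have "\<tau> * (2 * \<tau> + 1) \<le> \<nu> * (2 * \<nu> + 3)" using that by (intro mult_le_mono) auto
    then show ?thesis using assms(2) by linarith
  qed
  then have 1: "(\<Sum>\<tau> = 0..\<nu>. (-1) ^ \<tau> * int (p_o (?N - \<tau> * (2 * \<tau> + 1))))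
      = (\<Sum>\<tau> = 0..\<nu>. (-1) ^ \<tau> * int (p_o_int (int ?N - int (\<tau> * (2 * \<tau> + 1)))))"
    by (intro sum.cong refl) (simp only: p_o atLeastAtMost_iff)
  have "(\<tau> + 1) * (2 * \<tau> + 1) \<le> ?N" if "\<tau> < \<nu>" for \<tau>
  proof -
    have "(\<tau> + 1) * (2 * \<tau> + 1) \<le> \<nu> * (2 * \<nu> + 3)" using that by (intro mult_le_mono) auto
    then show ?thesis using assms(2) by linarith
  qed
  \<comment> \<open>Uses \<open>\<nu> \<ge> 1\<close>: at 0 the truncated bound would still admit
    \<open>\<tau> = 0\<close>.\<close>
  moreover have "{0..\<nu> - 1} = {..<\<nu>}" using assms(1) by auto
  ultimately have 2: "(\<Sum>\<tau> = 0..\<nu> - 1. (-1) ^ \<tau> * int (p_o (?N - (\<tau> + 1) * (2 * \<tau> + 1))))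
      = (\<Sum>\<tau> < \<nu>. (-1) ^ \<tau> * int (p_o_int (int ?N - int ((\<tau> + 1) * (2 * \<tau> + 1)))))"
    by (intro sum.cong) (simp_all only: p_o lessThan_iff)
  have "odd ?N" by simp
  then show ?thesis
    unfolding 1 2 truncated_sum_p_o_int[OF \<open>odd ?N\<close>] by (simp flip: mult.assoc power_mult_distrib)
qed

end
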